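(* Let $O=(0,0,0)$. Every equilateral triangle $OAB$ with $A,B\in\mathbb{Z}^3$ lying in the plane $\{(\alpha,\beta,\gamma):\alpha+\beta+\gamma=0\}$ satisfies $\{A,B\}=\{(m,-n,n-m),\,(m-n,-m,n)\}$ for some integers $m,n$, and its side length is $\sqrt{2(m^2-mn+n^2)}$. *)

theory Defs
  imports "HOL-Analysis.Analysis"
begin

definition equilateral_triangle :: "'a::euclidean_space \<Rightarrow> 'a \<Rightarrow> 'a \<Rightarrow> bool" where
  "equilateral_triangle P Q R \<longleftrightarrow>
     \<not> collinear {P, Q, R} \<and> dist P Q = dist Q R \<and> dist Q R = dist R P"

definition integer_points :: "(real ^ 3) set" where
  "integer_points = {x. \<forall>i. x $ i \<in> \<int>}"

definition zero_sum_plane :: "(real ^ 3) set" where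
  "zero_sum_plane = {x. x $ 1 + x $ 2 + x $ 3 = 0}"

end

theory Submission imports Defs
begin

text \<open>
  In the coordinates \<open>(a, b, - a - b)\<close> of the plane, the squared length is twice
  \<open>Q(a, b) = a\<^sup>2 + a b + b\<^sup>2\<close>. Given \<open>A\<close>, the three equal lengths say that \<open>B\<close> lies on a circle
  and on a line, which leaves only the two rotations of \<open>A\<close> by 60 degrees. These rotations
  are the integral maps \<open>(a, b, c) \<mapsto> (- c, - a, - b)\<close> and \<open>(a, b, c) \<mapsto> (- b, - c, - a)\<close>, inverse
  to each other, so after exchanging \<open>A\<close> and \<open>B\<close> if necessary \<open>B\<close> is the first rotation of \<open>A\<close>.
\<close>

lemma hexagonal_form_equilateral:
  fixes a b x y :: real
  assumes nz: "a\<^sup>2 + a * b + b\<^sup>2 \<noteq> 0"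
    and circle: "x\<^sup>2 + x * y + y\<^sup>2 = a\<^sup>2 + a * b + b\<^sup>2"
    and dist: "(x - a)\<^sup>2 + (x - a) * (y - b) + (y - b)\<^sup>2 = a\<^sup>2 + a * b + b\<^sup>2"
  shows "(x = a + b \<and> y = - a) \<or> (x = - b \<and> y = a + b)"
proof -
  have line: "x * (2 * a + b) + y * (a + 2 * b) = a\<^sup>2 + a * b + b\<^sup>2"
    using circle dist by (simp add: power2_eq_square algebra_simps)
  \<comment> \<open>Eliminating \<open>y\<close> between circle and line leaves a quadratic in
    \<open>x\<close> whose roots are the first coordinates of the two rotations; \<open>y\<close> is
    treated the same way.\<close>
  have "(a\<^sup>2 + a * b + b\<^sup>2) * ((x - a - b) * (x + b)) = 0"
    using circle line by algebra
  then have x: "x = a + b \<or> x = - b"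
    using nz by auto
  have "(a\<^sup>2 + a * b + b\<^sup>2) * ((y + a) * (y - a - b)) = 0"
    using circle line by algebra
  then have y: "y = - a \<or> y = a + b"
    using nz by auto
  \<comment> \<open>The roots for \<open>x\<close> and \<open>y\<close> might pair up wrongly. The
    line then makes \<open>a + b = - b\<close> or \<open>a + b = - a\<close>, so two roots coincide
    and the pair is a rotation after all.\<close>
  have degenerate: "a + 2 * b = 0 \<or> 2 * a + b = 0"
    if "(x = a + b \<and> y = a + b) \<or> (x = - b \<and> y = - a)"
  proof -
    have "(a + 2 * b) * (2 * a + b) = 0"
      using that line by (auto simp: power2_eq_square algebra_simps)
    then show ?thesis by simp
  qed
  show ?thesis
    using x y degenerate by auto
qed

text \<open>If the first two differences are \<open>u\<close> and \<open>v\<close>, the third is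
  \<open>- (u + v)\<close>, and the three squares add up to
  \<open>2 * (u\<^sup>2 + u * v + v\<^sup>2)\<close>.\<close>

lemma dist_zero_sum_plane:
  fixes P R :: "real ^ 3"
  assumes "P \<in> zero_sum_plane" and "R \<in> zero_sum_plane"
  shows "dist P R = sqrt (2 * ((P $ 1 - R $ 1)\<^sup>2 + (P $ 1 - R $ 1) * (P $ 2 - R $ 2)
                               + (P $ 2 - R $ 2)\<^sup>2))"
proof -
  have "P $ 3 = - P $ 1 - P $ 2" "R $ 3 = - R $ 1 - R $ 2"
    using assms by (auto simp: zero_sum_plane_def)
  then show ?thesis
    unfolding dist_norm norm_vec_def L2_set_def sum_3
    by (simp, simp add: power2_eq_square left_diff_distrib right_diff_distrib)
qed

theorem theorem4p2:
  fixes A B :: "real ^ 3"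
  assumes "A \<in> integer_points" and "B \<in> integer_points"
    and "equilateral_triangle 0 A B"
    and "{0, A, B} \<subseteq> zero_sum_plane"
  shows "\<exists>m n :: int.
    {A, B} = {vector [of_int m, of_int (- n), of_int (n - m)],
              vector [of_int (m - n), of_int (- m), of_int n]} \<and>
    dist 0 A = sqrt (of_int (2 * (m\<^sup>2 - m * n + n\<^sup>2))) \<and>
    dist A B = sqrt (of_int (2 * (m\<^sup>2 - m * n + n\<^sup>2))) \<and>
    dist B 0 = sqrt (of_int (2 * (m\<^sup>2 - m * n + n\<^sup>2)))"
proof -
  have planes: "0 \<in> zero_sum_plane" "A \<in> zero_sum_plane" "B \<in> zero_sum_plane"
    using assms(4) by auto
  then have A3: "A $ 3 = - A $ 1 - A $ 2" and B3: "B $ 3 = - B $ 1 - B $ 2"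
    by (auto simp: zero_sum_plane_def)
  obtain a b where a: "A $ 1 = of_int a" and b: "A $ 2 = of_int b"
    using assms(1) unfolding integer_points_def by (metis Ints_cases mem_Collect_eq)
  \<comment> \<open>\<open>A \<noteq> 0\<close> comes from non-collinearity and will make the form
    nonzero at \<open>A\<close>.\<close>
  have sides: "dist A B = dist 0 A" "dist B 0 = dist 0 A" and "A \<noteq> 0"
    using assms(3) by (auto simp: equilateral_triangle_def)
  have dist_A: "dist 0 A = sqrt (of_int (2 * (a\<^sup>2 + a * b + b\<^sup>2)))"
    using dist_zero_sum_plane[OF planes(1,2)] by (simp add: a b)
  have "(B $ 1 = A $ 1 + A $ 2 \<and> B $ 2 = - A $ 1) \<or> (B $ 1 = - A $ 2 \<and> B $ 2 = A $ 1 + A $ 2)"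
  proof (rule hexagonal_form_equilateral)
    show "(A $ 1)\<^sup>2 + A $ 1 * A $ 2 + (A $ 2)\<^sup>2 \<noteq> 0"
    proof
      assume "(A $ 1)\<^sup>2 + A $ 1 * A $ 2 + (A $ 2)\<^sup>2 = 0"
      then have "dist 0 A = sqrt (2 * 0)"
        unfolding dist_zero_sum_plane[OF planes(1,2)] by simp
      then show False
        using \<open>A \<noteq> 0\<close> by simp
    qed
    show "(B $ 1)\<^sup>2 + B $ 1 * B $ 2 + (B $ 2)\<^sup>2 = (A $ 1)\<^sup>2 + A $ 1 * A $ 2 + (A $ 2)\<^sup>2"
      using sides(2) dist_zero_sum_plane[OF planes(1,2)] dist_zero_sum_plane[OF planes(3,1)]
      by simp
    show "(B $ 1 - A $ 1)\<^sup>2 + (B $ 1 - A $ 1) * (B $ 2 - A $ 2) + (B $ 2 - A $ 2)\<^sup>2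
        = (A $ 1)\<^sup>2 + A $ 1 * A $ 2 + (A $ 2)\<^sup>2"
      using sides(1) dist_zero_sum_plane[OF planes(1,2)] dist_zero_sum_plane[OF planes(3,2)]
      by (simp add: dist_commute)
  qed
  then show ?thesis
  proof
    assume B: "B $ 1 = A $ 1 + A $ 2 \<and> B $ 2 = - A $ 1"
    \<comment> \<open>Here \<open>A\<close> is the first listed vector, which forces
      \<open>m = a\<close> and \<open>n = - b\<close>.\<close>
    have "A = vector [of_int a, of_int (- (- b)), of_int (- b - a)]"
      by (simp add: vec_eq_iff forall_3 A3 a b)
    moreover have "B = vector [of_int (a - (- b)), of_int (- a), of_int (- b)]"
      using B by (simp add: vec_eq_iff forall_3 B3 a b)
    moreover have "a\<^sup>2 - a * (- b) + (- b)\<^sup>2 = a\<^sup>2 + a * b + b\<^sup>2"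
      by simp
    ultimately show ?thesis
      using sides dist_A by (intro exI[of _ a] exI[of _ "- b"]) simp
  next
    assume B: "B $ 1 = - A $ 2 \<and> B $ 2 = A $ 1 + A $ 2"
    \<comment> \<open>Now \<open>A\<close> is the second listed vector: \<open>- m\<close> and
      \<open>n\<close> are read off from its last two coordinates.\<close>
    define m n where "m = - b" and "n = - a - b"
    have "B = vector [of_int m, of_int (- n), of_int (n - m)]"
      using B by (simp add: vec_eq_iff forall_3 B3 a b m_def n_def)
    moreover have "A = vector [of_int (m - n), of_int (- m), of_int n]"
      by (simp add: vec_eq_iff forall_3 A3 a b m_def n_def)
    moreover have "m\<^sup>2 - m * n + n\<^sup>2 = a\<^sup>2 + a * b + b\<^sup>2"
      by (simp add: m_def n_def power2_eq_square algebra_simps)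
    ultimately show ?thesis
      using sides dist_A by (intro exI[of _ m] exI[of _ n]) (simp add: insert_commute)
  qed
qed

end
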